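(* Let $(M^{m+d},H,g_H)$ be a compact connected sub-Riemannian manifold with $g_H=g|_H$ for a Riemannian metric $g$ on $M$, let $(N^n,h)$ be a Riemannian manifold, and let $f:M\to N$ be an exponentially subelliptic harmonic map. If the sectional curvature of $N$ is everywhere nonpositive, then $f$ is stable.
   Context: Manifolds are without boundary. Let $(M^{m+d},g)$ be a compact connected Riemannian manifold of dimension $m+d$, $H\subset TM$ a smooth subbundle of rank $m$, and $g_H=g|_H$; the triple $(M,H,g_H)$ is called a sub-Riemannian manifold (no further condition on $H$ is imposed). $TM=H\oplus H^\perp$ is the $g$-orthogonal decomposition, $\pi_H:TM\to H$ is the orthogonal projection, and $\{e_1,\dots,e_m\}$ is a local $g$-orthonormal frame of $H$. $dv_g$ is the Riemannian volume element. For a smooth map $f:M\to N$ into a Riemannian manifold $(N,h)$, $\langle\cdot,\cdot\rangle$ on $f^{-1}TN$ is induced by $h$, $\tilde\nabla$ (acting on sections of $f^{-1}TN$) is the pull-back of the Levi-Civita connection of $(N,h)$, $df_H=df\circ\pi_H$, and $|df_H|^2=\sum_{i=1}^m\langle df(e_i),df(e_i)\rangle$. $\tilde R$ is the curvature tensor of $N$, with the convention $\tilde R(X,Y)Z=\tilde\nabla_X\tilde\nabla_YZ-\tilde\nabla_Y\tilde\nabla_XZ-\tilde\nabla_{[X,Y]}Z$, so that $\langle\tilde R(X,Y)Y,X\rangle$ is the sectional curvature of the plane spanned by orthonormal $X,Y$. The horizontal exponential energy is $E(f)=\int_M e^{\frac{|df_H|^2}{2}}\,dv_g$. A smooth map $f$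 is called exponentially subelliptic harmonic if it is a critical point of $E$, i.e. $\frac{d}{dt}E(f_t)|_{t=0}=0$ for every smooth one-parameter family $f_t$ with $f_0=f$ whose variation vector field has compact support. For an exponentially subelliptic harmonic map $f$ and $V\in\Gamma(f^{-1}TN)$ put $$I_H(V,V)=\int_M e^{\frac{|df_H|^2}{2}}\Big[\Big(\sum_{i=1}^m\langle\tilde\nabla_{e_i}V,df(e_i)\rangle\Big)^2+\sum_{i=1}^m\langle\tilde\nabla_{e_i}V,\tilde\nabla_{e_i}V\rangle-\sum_{i=1}^m\langle\tilde R(df(e_i),V)V,df(e_i)\rangle\Big]dv_g.$$ $f$ is called stable if $I_H(V,V)\ge0$ for every compactly supported smooth vector field $V$ along $f$. *)

theory Defs
  imports "HOL-Analysis.Analysis"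
begin

section \<open>Smooth functions and smooth manifolds\<close>

text \<open>These two notions are only used for functions on open sets of a Euclidean space.\<close>

primrec Ck_on :: "nat \<Rightarrow> 'a::real_normed_vector set \<Rightarrow> ('a \<Rightarrow> 'b::real_normed_vector) \<Rightarrow> bool" where
  "Ck_on 0 S f \<longleftrightarrow> continuous_on S f"
| "Ck_on (Suc k) S f \<longleftrightarrow>
     (\<forall>x\<in>S. f differentiable (at x)) \<and> (\<forall>v. Ck_on k S (\<lambda>x. frechet_derivative f (at x) v))"

definition smooth_on :: "'a::real_normed_vector set \<Rightarrow> ('a \<Rightarrow> 'b::real_normed_vector) \<Rightarrow> bool" where
  "smooth_on S f \<longleftrightarrow> (\<forall>k. Ck_on k S f)"

text \<open>A chart is a domain together with a coordinate map; the values of the coordinate map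
  outside the domain are irrelevant.  The atlas need not be maximal.\<close>

type_synonym ('a, 'n) chart = "'a set \<times> ('a \<Rightarrow> real ^ 'n)"

record ('a, 'n::finite) mfd =
  topo :: "'a topology"
  atlas :: "('a, 'n) chart set"

abbreviation pts :: "('a, 'n::finite) mfd \<Rightarrow> 'a set" where
  "pts M \<equiv> topspace (topo M)"

abbreviation dom_c :: "('a, 'n::finite) chart \<Rightarrow> 'a set" where
  "dom_c c \<equiv> fst c"

abbreviation map_c :: "('a, 'n::finite) chart \<Rightarrow> 'a \<Rightarrow> real ^ 'n" where
  "map_c c \<equiv> snd c"

definition inv_c :: "('a, 'n::finite) chart \<Rightarrow> real ^ 'n \<Rightarrow> 'a" where
  "inv_c c = inv_into (dom_c c) (map_c c)"

definition coord :: "('a, 'n::finite) chart \<Rightarrow> 'n \<Rightarrow> 'a \<Rightarrow> real" where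
  "coord c k = (\<lambda>p. map_c c p $ k)"

definition smooth_manifold :: "('a, 'n::finite) mfd \<Rightarrow> bool" where
  "smooth_manifold M \<longleftrightarrow>
     Hausdorff_space (topo M) \<and> second_countable (topo M) \<and>
     (\<Union>c\<in>atlas M. dom_c c) = pts M \<and>
     (\<forall>c\<in>atlas M. openin (topo M) (dom_c c) \<and> open (map_c c ` dom_c c) \<and>
        homeomorphic_map (subtopology (topo M) (dom_c c))
          (top_of_set (map_c c ` dom_c c)) (map_c c)) \<and>
     (\<forall>c\<in>atlas M. \<forall>d\<in>atlas M.
        smooth_on (map_c c ` (dom_c c \<inter> dom_c d)) (map_c d \<circ> inv_c c))"

definition chart_at :: "('a, 'n::finite) mfd \<Rightarrow> 'a \<Rightarrow> ('a, 'n) chart" where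
  "chart_at M p = (SOME c. c \<in> atlas M \<and> p \<in> dom_c c)"

definition smooth_fun_on :: "('a, 'n::finite) mfd \<Rightarrow> 'a set \<Rightarrow> ('a \<Rightarrow> real) \<Rightarrow> bool" where
  "smooth_fun_on M U \<phi> \<longleftrightarrow>
     (\<forall>c\<in>atlas M. smooth_on (map_c c ` (dom_c c \<inter> U)) (\<phi> \<circ> inv_c c))"

definition smooth_near :: "('a, 'n::finite) mfd \<Rightarrow> 'a \<Rightarrow> ('a \<Rightarrow> real) \<Rightarrow> bool" where
  "smooth_near M p \<phi> \<longleftrightarrow> (\<exists>U. openin (topo M) U \<and> p \<in> U \<and> smooth_fun_on M U \<phi>)"

definition smooth_map ::
  "('a, 'm::finite) mfd \<Rightarrow> ('b, 'n::finite) mfd \<Rightarrow> ('a \<Rightarrow> 'b) \<Rightarrow> bool" where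
  "smooth_map M N f \<longleftrightarrow>
     continuous_map (topo M) (topo N) f \<and>
     (\<forall>c\<in>atlas M. \<forall>d\<in>atlas N.
        smooth_on (map_c c ` {p \<in> dom_c c. f p \<in> dom_c d}) (map_c d \<circ> f \<circ> inv_c c))"

section \<open>Tangent vectors and vector fields\<close>

text \<open>A tangent vector at \<open>p\<close> is a derivation of the functions smooth near \<open>p\<close>.
  To make equality of tangent vectors extensional, it is required to
  vanish on all other functions.  That a derivation depends only on germs follows from the
  product rule.\<close>

type_synonym 'a tvec = "('a \<Rightarrow> real) \<Rightarrow> real"

definition tangent_space :: "('a, 'n::finite) mfd \<Rightarrow> 'a \<Rightarrow> 'a tvec set" where
  "tangent_space M p =
     {X. (\<forall>\<phi>. \<not> smooth_near M p \<phi> \<longrightarrow> X \<phi> = 0) \<and>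
         (\<forall>\<phi> \<psi>. smooth_near M p \<phi> \<longrightarrow> smooth_near M p \<psi> \<longrightarrow>
            X (\<lambda>q. \<phi> q + \<psi> q) = X \<phi> + X \<psi> \<and>
            X (\<lambda>q. \<phi> q * \<psi> q) = X \<phi> * \<psi> p + \<phi> p * X \<psi>) \<and>
         (\<forall>\<phi> a. smooth_near M p \<phi> \<longrightarrow> X (\<lambda>q. a * \<phi> q) = a * X \<phi>)}"

definition lincomb :: "'i set \<Rightarrow> ('i \<Rightarrow> real) \<Rightarrow> ('i \<Rightarrow> 'a tvec) \<Rightarrow> 'a tvec" where
  "lincomb I a X = (\<lambda>\<phi>. \<Sum>i\<in>I. a i * X i \<phi>)"

definition coord_vec :: "('a, 'n::finite) mfd \<Rightarrow> ('a, 'n) chart \<Rightarrow> 'n \<Rightarrow> 'a \<Rightarrow> 'a tvec" where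
  "coord_vec M c k p =
     (\<lambda>\<phi>. if smooth_near M p \<phi>
          then frechet_derivative (\<phi> \<circ> inv_c c) (at (map_c c p)) (axis k 1) else 0)"

definition push ::
  "('b, 'n::finite) mfd \<Rightarrow> ('a \<Rightarrow> 'b) \<Rightarrow> 'a \<Rightarrow> 'a tvec \<Rightarrow> 'b tvec" where
  "push N f p X = (\<lambda>\<phi>. if smooth_near N (f p) \<phi> then X (\<phi> \<circ> f) else 0)"

definition smooth_field_along_on ::
  "('a, 'm::finite) mfd \<Rightarrow> ('b, 'n::finite) mfd \<Rightarrow> ('a \<Rightarrow> 'b) \<Rightarrow> 'a set \<Rightarrow> ('a \<Rightarrow> 'b tvec) \<Rightarrow> bool" where
  "smooth_field_along_on M N f U V \<longleftrightarrow>
     (\<forall>p\<in>U. V p \<in> tangent_space N (f p)) \<and>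
     (\<forall>d\<in>atlas N. \<forall>k. smooth_fun_on M {p \<in> U. f p \<in> dom_c d} (\<lambda>p. V p (coord d k)))"

definition smooth_field_on :: "('a, 'n::finite) mfd \<Rightarrow> 'a set \<Rightarrow> ('a \<Rightarrow> 'a tvec) \<Rightarrow> bool" where
  "smooth_field_on M U X \<longleftrightarrow> smooth_field_along_on M M (\<lambda>p. p) U X"

definition compact_support :: "('a, 'm::finite) mfd \<Rightarrow> ('a \<Rightarrow> 'b tvec) \<Rightarrow> bool" where
  "compact_support M V \<longleftrightarrow>
     compactin (topo M) (topo M closure_of {p \<in> pts M. V p \<noteq> (\<lambda>_. 0)})"

definition bracket :: "('a, 'n::finite) mfd \<Rightarrow> ('a \<Rightarrow> 'a tvec) \<Rightarrow> ('a \<Rightarrow> 'a tvec) \<Rightarrow> 'a \<Rightarrow> 'a tvec" where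
  "bracket M X Y p =
     (\<lambda>\<phi>. if smooth_near M p \<phi> then X p (\<lambda>q. Y q \<phi>) - Y p (\<lambda>q. X q \<phi>) else 0)"

section \<open>Riemannian metrics and the volume measure\<close>

type_synonym 'a metric_tensor = "'a \<Rightarrow> 'a tvec \<Rightarrow> 'a tvec \<Rightarrow> real"

definition riemannian_metric :: "('a, 'n::finite) mfd \<Rightarrow> 'a metric_tensor \<Rightarrow> bool" where
  "riemannian_metric M g \<longleftrightarrow>
     (\<forall>p\<in>pts M. \<forall>X\<in>tangent_space M p. \<forall>Y\<in>tangent_space M p.
        g p X Y = g p Y X \<and>
        (\<forall>Z\<in>tangent_space M p. \<forall>a b.
           g p (\<lambda>\<phi>. a * X \<phi> + b * Y \<phi>) Z = a * g p X Z + b * g p Y Z)) \<and>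
     (\<forall>p\<in>pts M. \<forall>X\<in>tangent_space M p. X \<noteq> (\<lambda>_. 0) \<longrightarrow> 0 < g p X X) \<and>
     (\<forall>c\<in>atlas M. \<forall>i j.
        smooth_fun_on M (dom_c c) (\<lambda>p. g p (coord_vec M c i p) (coord_vec M c j p)))"

definition riemannian_manifold :: "('a, 'n::finite) mfd \<Rightarrow> 'a metric_tensor \<Rightarrow> bool" where
  "riemannian_manifold M g \<longleftrightarrow> smooth_manifold M \<and> riemannian_metric M g"

text \<open>The Riemannian volume is the unique Borel measure which in every chart
  has density \<open>sqrt (det (g\<^sub>i\<^sub>j))\<close> with respect to Lebesgue measure.\<close>

definition riemannian_volume :: "('a, 'n::finite) mfd \<Rightarrow> 'a metric_tensor \<Rightarrow> 'a measure" where
  "riemannian_volume M g =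
     (THE \<mu>. space \<mu> = pts M \<and> sets \<mu> = sigma_sets (pts M) {U. openin (topo M) U} \<and>
        (\<forall>c\<in>atlas M. \<forall>B\<in>sets \<mu>. B \<subseteq> dom_c c \<longrightarrow>
           emeasure \<mu> B =
             (\<integral>\<^sup>+ x. ennreal (sqrt (det (\<chi> i j. g (inv_c c x) (coord_vec M c i (inv_c c x))
                                                        (coord_vec M c j (inv_c c x)))))
                  * indicator (map_c c ` B) x \<partial>lborel)))"

section \<open>Levi-Civita connection, curvature, pull-back connection\<close>

text \<open>\<open>D q u Y\<close> is the covariant derivative at \<open>q\<close> of the vector field \<open>Y\<close> in the
  direction \<open>u\<close>.  The field only needs to be defined and smooth near \<open>q\<close>.  The Levi-Civita
  connection is the torsion-free connection compatible with the metric.\<close>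

type_synonym 'a connection = "'a \<Rightarrow> 'a tvec \<Rightarrow> ('a \<Rightarrow> 'a tvec) \<Rightarrow> 'a tvec"

definition affine_connection :: "('a, 'n::finite) mfd \<Rightarrow> 'a connection \<Rightarrow> bool" where
  "affine_connection N D \<longleftrightarrow>
     (\<forall>U Y q. openin (topo N) U \<and> q \<in> U \<and> smooth_field_on N U Y \<longrightarrow>
        (\<forall>u\<in>tangent_space N q.
           D q u Y \<in> tangent_space N q \<and>
           (\<forall>v\<in>tangent_space N q. \<forall>a b.
              D q (\<lambda>\<phi>. a * u \<phi> + b * v \<phi>) Y = (\<lambda>\<phi>. a * D q u Y \<phi> + b * D q v Y \<phi>)) \<and>
           (\<forall>Z. smooth_field_on N U Z \<longrightarrow>
              D q u (\<lambda>r \<phi>. Y r \<phi> + Z r \<phi>) = (\<lambda>\<phi>. D q u Y \<phi> + D q u Z \<phi>)) \<and>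
           (\<forall>\<eta>. smooth_fun_on N U \<eta> \<longrightarrow>
              D q u (\<lambda>r \<phi>. \<eta> r * Y r \<phi>) = (\<lambda>\<phi>. u \<eta> * Y q \<phi> + \<eta> q * D q u Y \<phi>)))) \<and>
     (\<forall>U X Y. openin (topo N) U \<and> smooth_field_on N U X \<and> smooth_field_on N U Y \<longrightarrow>
        smooth_field_on N U (\<lambda>q. D q (X q) Y))"

definition levi_civita :: "('a, 'n::finite) mfd \<Rightarrow> 'a metric_tensor \<Rightarrow> 'a connection \<Rightarrow> bool" where
  "levi_civita N h D \<longleftrightarrow>
     affine_connection N D \<and>
     (\<forall>U X Y q. openin (topo N) U \<and> q \<in> U \<and> smooth_field_on N U X \<and> smooth_field_on N U Y \<longrightarrow>
        (\<lambda>\<phi>. D q (X q) Y \<phi> - D q (Y q) X \<phi>) = bracket N X Y q) \<and>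
     (\<forall>U Y Z q. openin (topo N) U \<and> q \<in> U \<and> smooth_field_on N U Y \<and> smooth_field_on N U Z \<longrightarrow>
        (\<forall>u\<in>tangent_space N q.
           u (\<lambda>r. h r (Y r) (Z r)) = h q (D q u Y) (Z q) + h q (Y q) (D q u Z)))"

definition curvature_field ::
  "('a, 'n::finite) mfd \<Rightarrow> 'a connection \<Rightarrow> ('a \<Rightarrow> 'a tvec) \<Rightarrow> ('a \<Rightarrow> 'a tvec) \<Rightarrow> ('a \<Rightarrow> 'a tvec)
     \<Rightarrow> 'a \<Rightarrow> 'a tvec" where
  "curvature_field N D X Y Z q =
     (\<lambda>\<phi>. D q (X q) (\<lambda>r. D r (Y r) Z) \<phi> - D q (Y q) (\<lambda>r. D r (X r) Z) \<phi>
          - D q (bracket N X Y q) Z \<phi>)"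

definition extend_const ::
  "('a, 'n::finite) mfd \<Rightarrow> ('a, 'n) chart \<Rightarrow> 'a tvec \<Rightarrow> 'a \<Rightarrow> 'a tvec" where
  "extend_const N c u q = lincomb UNIV (\<lambda>k. u (coord c k)) (\<lambda>k. coord_vec N c k q)"

text \<open>The curvature tensor at a point: by tensoriality the value does not
  depend on how the three vectors are extended to vector fields near \<open>q\<close>; the extension
  with constant components in some chart around \<open>q\<close> is used.\<close>

definition curvature ::
  "('a, 'n::finite) mfd \<Rightarrow> 'a connection \<Rightarrow> 'a \<Rightarrow> 'a tvec \<Rightarrow> 'a tvec \<Rightarrow> 'a tvec \<Rightarrow> 'a tvec" where
  "curvature N D q u v w =
     (let E = extend_const N (chart_at N q) in curvature_field N D (E u) (E v) (E w) q)"

definition sectional_curvature ::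
  "('a, 'n::finite) mfd \<Rightarrow> 'a metric_tensor \<Rightarrow> 'a connection \<Rightarrow> 'a \<Rightarrow> 'a tvec \<Rightarrow> 'a tvec \<Rightarrow> real" where
  "sectional_curvature N h D q X Y =
     h q (curvature N D q X Y Y) X / (h q X X * h q Y Y - (h q X Y)\<^sup>2)"

definition nonpositive_sectional_curvature ::
  "('a, 'n::finite) mfd \<Rightarrow> 'a metric_tensor \<Rightarrow> 'a connection \<Rightarrow> bool" where
  "nonpositive_sectional_curvature N h D \<longleftrightarrow>
     (\<forall>q\<in>pts N. \<forall>X\<in>tangent_space N q. \<forall>Y\<in>tangent_space N q.
        (\<forall>a b. (\<lambda>\<phi>. a * X \<phi> + b * Y \<phi>) = (\<lambda>_. 0) \<longrightarrow> a = 0 \<and> b = 0) \<longrightarrow>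
        sectional_curvature N h D q X Y \<le> 0)"

text \<open>For \<open>V = \<Sum>\<^sub>k V\<^sup>k \<partial>\<^sub>k \<circ> f\<close> in a chart around \<open>f p\<close>, the pull-back connection in the
  direction \<open>X\<close> at \<open>p\<close> is \<open>\<Sum>\<^sub>k (X(V\<^sup>k) \<partial>\<^sub>k + V\<^sup>k D\<^bsub>df(X)\<^esub> \<partial>\<^sub>k)\<close>, independently of the chart.\<close>

definition pullback_connection ::
  "('b, 'n::finite) mfd \<Rightarrow> 'b connection \<Rightarrow> ('a \<Rightarrow> 'b) \<Rightarrow> 'a \<Rightarrow> 'a tvec \<Rightarrow> ('a \<Rightarrow> 'b tvec)
     \<Rightarrow> 'b tvec" where
  "pullback_connection N D f p X V =
     (let d = chart_at N (f p) in
      (\<lambda>\<phi>. \<Sum>k\<in>UNIV. X (\<lambda>q. V q (coord d k)) * coord_vec N d k (f p) \<phi>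
                    + V p (coord d k) * D (f p) (push N f p X) (coord_vec N d k) \<phi>))"

section \<open>Sub-Riemannian manifolds\<close>

definition smooth_subbundle ::
  "('a, 'm::finite) mfd \<Rightarrow> nat \<Rightarrow> ('a \<Rightarrow> 'a tvec set) \<Rightarrow> bool" where
  "smooth_subbundle M m H \<longleftrightarrow>
     (\<forall>p\<in>pts M. \<exists>U E. openin (topo M) U \<and> p \<in> U \<and> (\<forall>i<m. smooth_field_on M U (E i)) \<and>
        (\<forall>q\<in>U. (\<forall>a. lincomb {..<m} a (\<lambda>i. E i q) = (\<lambda>_. 0) \<longrightarrow> (\<forall>i<m. a i = 0)) \<and>
               H q = range (\<lambda>a. lincomb {..<m} a (\<lambda>i. E i q))))"

definition sub_riemannian_manifold ::
  "('a, 'm::finite) mfd \<Rightarrow> 'a metric_tensor \<Rightarrow> nat \<Rightarrow> ('a \<Rightarrow> 'a tvec set) \<Rightarrow> bool" where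
  "sub_riemannian_manifold M g m H \<longleftrightarrow> riemannian_manifold M g \<and> smooth_subbundle M m H"

definition orthonormal_frame_at ::
  "'a metric_tensor \<Rightarrow> nat \<Rightarrow> ('a \<Rightarrow> 'a tvec set) \<Rightarrow> 'a \<Rightarrow> (nat \<Rightarrow> 'a tvec) \<Rightarrow> bool" where
  "orthonormal_frame_at g m H p e \<longleftrightarrow>
     H p = range (\<lambda>a. lincomb {..<m} a e) \<and>
     (\<forall>i<m. e i \<in> H p) \<and> (\<forall>i<m. \<forall>j<m. g p (e i) (e j) = (if i = j then 1 else 0))"

text \<open>All quantities below are pointwise traces over \<open>H p\<close>, hence independent of the
  orthonormal basis; one is chosen at each point.\<close>

definition frame ::
  "'a metric_tensor \<Rightarrow> nat \<Rightarrow> ('a \<Rightarrow> 'a tvec set) \<Rightarrow> 'a \<Rightarrow> nat \<Rightarrow> 'a tvec" where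
  "frame g m H p = (SOME e. orthonormal_frame_at g m H p e)"

section \<open>Exponentially subelliptic harmonic maps and stability\<close>

definition norm2_dfH ::
  "'a metric_tensor \<Rightarrow> nat \<Rightarrow> ('a \<Rightarrow> 'a tvec set) \<Rightarrow> ('b, 'n::finite) mfd \<Rightarrow> 'b metric_tensor
     \<Rightarrow> ('a \<Rightarrow> 'b) \<Rightarrow> 'a \<Rightarrow> real" where
  "norm2_dfH g m H N h f p =
     (\<Sum>i<m. h (f p) (push N f p (frame g m H p i)) (push N f p (frame g m H p i)))"

definition exp_energy ::
  "('a, 'k::finite) mfd \<Rightarrow> 'a metric_tensor \<Rightarrow> nat \<Rightarrow> ('a \<Rightarrow> 'a tvec set)
     \<Rightarrow> ('b, 'n::finite) mfd \<Rightarrow> 'b metric_tensor \<Rightarrow> ('a \<Rightarrow> 'b) \<Rightarrow> real" where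
  "exp_energy M g m H N h f =
     (LINT p:pts M|riemannian_volume M g. exp (norm2_dfH g m H N h f p / 2))"

definition smooth_variation ::
  "('a, 'k::finite) mfd \<Rightarrow> ('b, 'n::finite) mfd \<Rightarrow> ('a \<Rightarrow> 'b) \<Rightarrow> real \<Rightarrow> (real \<Rightarrow> 'a \<Rightarrow> 'b) \<Rightarrow> bool" where
  "smooth_variation M N f \<epsilon> F \<longleftrightarrow>
     0 < \<epsilon> \<and> (\<forall>p\<in>pts M. F 0 p = f p) \<and>
     continuous_map (prod_topology (top_of_set {-\<epsilon><..<\<epsilon>}) (topo M)) (topo N) (\<lambda>(t, p). F t p) \<and>
     (\<forall>c\<in>atlas M. \<forall>d\<in>atlas N.
        smooth_on {(t, x). t \<in> {-\<epsilon><..<\<epsilon>} \<and> x \<in> map_c c ` dom_c c \<and> F t (inv_c c x) \<in> dom_c d}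
          (\<lambda>(t, x). map_c d (F t (inv_c c x))))"

definition variation_field ::
  "('b, 'n::finite) mfd \<Rightarrow> (real \<Rightarrow> 'a \<Rightarrow> 'b) \<Rightarrow> 'a \<Rightarrow> 'b tvec" where
  "variation_field N F p =
     (\<lambda>\<phi>. if smooth_near N (F 0 p) \<phi> then deriv (\<lambda>t. \<phi> (F t p)) 0 else 0)"

definition exp_subelliptic_harmonic ::
  "('a, 'k::finite) mfd \<Rightarrow> 'a metric_tensor \<Rightarrow> nat \<Rightarrow> ('a \<Rightarrow> 'a tvec set)
     \<Rightarrow> ('b, 'n::finite) mfd \<Rightarrow> 'b metric_tensor \<Rightarrow> ('a \<Rightarrow> 'b) \<Rightarrow> bool" where
  "exp_subelliptic_harmonic M g m H N h f \<longleftrightarrow>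
     smooth_map M N f \<and>
     (\<forall>\<epsilon> F. smooth_variation M N f \<epsilon> F \<and> compact_support M (variation_field N F) \<longrightarrow>
        ((\<lambda>t. exp_energy M g m H N h (F t)) has_real_derivative 0) (at 0))"

definition index_form ::
  "('a, 'k::finite) mfd \<Rightarrow> 'a metric_tensor \<Rightarrow> nat \<Rightarrow> ('a \<Rightarrow> 'a tvec set)
     \<Rightarrow> ('b, 'n::finite) mfd \<Rightarrow> 'b metric_tensor \<Rightarrow> 'b connection \<Rightarrow> ('a \<Rightarrow> 'b)
     \<Rightarrow> ('a \<Rightarrow> 'b tvec) \<Rightarrow> real" where
  "index_form M g m H N h D f V =
     (LINT p:pts M|riemannian_volume M g.
        (let e = frame g m H p;
             df = push N f p;
             nabV = (\<lambda>i. pullback_connection N D f p (e i) V)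
         in exp (norm2_dfH g m H N h f p / 2) *
            ((\<Sum>i<m. h (f p) (nabV i) (df (e i)))\<^sup>2
             + (\<Sum>i<m. h (f p) (nabV i) (nabV i))
             - (\<Sum>i<m. h (f p) (curvature N D (f p) (df (e i)) (V p) (V p)) (df (e i))))))"

definition exp_subelliptic_stable ::
  "('a, 'k::finite) mfd \<Rightarrow> 'a metric_tensor \<Rightarrow> nat \<Rightarrow> ('a \<Rightarrow> 'a tvec set)
     \<Rightarrow> ('b, 'n::finite) mfd \<Rightarrow> 'b metric_tensor \<Rightarrow> 'b connection \<Rightarrow> ('a \<Rightarrow> 'b) \<Rightarrow> bool" where
  "exp_subelliptic_stable M g m H N h D f \<longleftrightarrow>
     (\<forall>V. smooth_field_along_on M N f (pts M) V \<and> compact_support M V \<longrightarrow>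
        0 \<le> index_form M g m H N h D f V)"

end

theory Submission
  imports Defs
begin

text \<open>The integrand of \<open>I\<^sub>H(V,V)\<close> is nonnegative at every point, and this gives the sign of the
  integral.  The exponential is positive, the first term in the bracket is a square, and the second
  is a sum of squared norms of the vectors \<open>\<nabla>\<^bsub>e\<^sub>i\<^esub> V\<close>.  In the curvature term
  \<open>\<langle>R(X,V)V,X\<rangle>\<close> with \<open>X = df(e\<^sub>i)\<close>, if \<open>X\<close> and \<open>V\<close> are linearly independent, the value is the
  sectional curvature of their plane times the positive Gram determinant
  \<open>|X|\<^sup>2 |V|\<^sup>2 - \<langle>X,V\<rangle>\<^sup>2\<close>, hence at most zero.  If they are dependent there is no plane, and one needs
  \<open>R(sZ,tZ) = 0\<close>.

  Most of the work is in showing that these expressions mean what they should, since tangent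
  vectors are derivations and the metric is only known to be bilinear and positive on tangent
  spaces.  The vectors \<open>df(e\<^sub>i)\<close> are tangent because the composition of a smooth function with a
  smooth map is smooth (\<open>push_tangent\<close>), which rests on the chain rule for \<open>C\<^sup>k\<close> functions.  The
  covariant derivatives \<open>\<nabla>\<^bsub>e\<^sub>i\<^esub> V\<close> are tangent because the coordinate fields are smooth
  (\<open>pullback_connection_tangent\<close>).  The frame is chosen by a choice operator, so nothing is known
  about it until an orthonormal basis of \<open>H p\<close> is shown to exist by the Gram-Schmidt process
  (\<open>frame_orthonormal\<close>).  The curvature of parallel vectors vanishes
  (\<open>curvature_parallel\<close>) because the two second derivatives in its definition coincide and the bracket
  is zero; comparing the second derivatives uses the locality of a connection
  (\<open>connection_local\<close>).\<close>

section \<open>Calculus of \<open>C\<^sup>k\<close> functions on open sets\<close>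

lemma Ck_on_subset: "Ck_on k S f \<Longrightarrow> T \<subseteq> S \<Longrightarrow> Ck_on k T f"
  by (induction k arbitrary: f) (auto intro: continuous_on_subset)

lemma Ck_on_cong:
  assumes "open S" "\<And>x. x \<in> S \<Longrightarrow> f x = g x" "Ck_on k S f"
  shows "Ck_on k S g"
  using assms(2,3)
proof (induction k arbitrary: f g)
  case 0
  then show ?case using continuous_on_cong by (metis Ck_on.simps(1))
next
  case (Suc k)
  have der: "(g has_derivative frechet_derivative f (at x)) (at x)" if "x \<in> S" for x
  proof (rule has_derivative_transform_within_open[OF _ assms(1) that])
    show "(f has_derivative frechet_derivative f (at x)) (at x)"
      using Suc.prems that by (simp add: frechet_derivative_works)
  qed (use Suc.prems in auto)
  then have eq: "frechet_derivative g (at x) = frechet_derivative f (at x)" if "x \<in> S" for x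
    using that frechet_derivative_at by metis
  have "Ck_on k S (\<lambda>x. frechet_derivative g (at x) v)" for v
    by (rule Suc.IH[of "\<lambda>x. frechet_derivative f (at x) v"]) (use Suc.prems eq in auto)
  moreover have "\<forall>x\<in>S. g differentiable (at x)"
    using der differentiableI by blast
  ultimately show ?case by simp
qed

lemma Ck_on_SucI:
  assumes "open S" "\<And>x. x \<in> S \<Longrightarrow> (f has_derivative f' x) (at x)"
    "\<And>v. Ck_on k S (\<lambda>x. f' x v)"
  shows "Ck_on (Suc k) S f"
proof -
  have "Ck_on k S (\<lambda>x. frechet_derivative f (at x) v)" for v
    by (rule Ck_on_cong[OF assms(1) _ assms(3)[of v]]) (metis assms(2) frechet_derivative_at)
  then show ?thesis using assms(2) by (auto intro: differentiableI)
qed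

lemma Ck_on_Suc_derivative:
  "Ck_on (Suc k) S f \<Longrightarrow> x \<in> S \<Longrightarrow> (f has_derivative frechet_derivative f (at x)) (at x)"
  by (simp add: frechet_derivative_works)

lemma Ck_on_SucD: "Ck_on (Suc k) S f \<Longrightarrow> Ck_on k S f"
proof (induction k arbitrary: f)
  case 0
  then show ?case
    by (auto intro!: continuous_at_imp_continuous_on differentiable_imp_continuous_within)
next
  case (Suc k)
  then show ?case by (metis Ck_on.simps(2))
qed

lemma Ck_on_const: "open S \<Longrightarrow> Ck_on k S (\<lambda>_. c)"
proof (induction k arbitrary: c)
  case (Suc k)
  show ?case by (rule Ck_on_SucI[where f' = "\<lambda>_ _. 0"]) (use Suc in auto)
qed simp

lemma Ck_on_add:
  assumes "open S" "Ck_on k S f" "Ck_on k S g"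
  shows "Ck_on k S (\<lambda>x. f x + g x)"
  using assms(2,3)
proof (induction k arbitrary: f g)
  case (Suc k)
  show ?case
    by (rule Ck_on_SucI[OF assms(1)])
      (rule has_derivative_add[OF Ck_on_Suc_derivative Ck_on_Suc_derivative], use Suc in auto)
qed (auto intro: continuous_intros)

lemma Ck_on_sum:
  assumes "open S" "finite I" "\<And>i. i \<in> I \<Longrightarrow> Ck_on k S (f i)"
  shows "Ck_on k S (\<lambda>x. \<Sum>i\<in>I. f i x)"
  using assms(2,3) by (induction I rule: finite_induct) (auto intro: Ck_on_const Ck_on_add assms(1))

lemma Ck_on_mult:
  fixes f g :: "'a::real_normed_vector \<Rightarrow> real"
  assumes "open S" "Ck_on k S f" "Ck_on k S g"
  shows "Ck_on k S (\<lambda>x. f x * g x)"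
  using assms(2,3)
proof (induction k arbitrary: f g)
  case (Suc k)
  show ?case
  proof (rule Ck_on_SucI[OF assms(1)])
    fix x assume "x \<in> S"
    then show "((\<lambda>x. f x * g x) has_derivative
        (\<lambda>v. f x * frechet_derivative g (at x) v + frechet_derivative f (at x) v * g x)) (at x)"
      by (intro has_derivative_mult Ck_on_Suc_derivative[OF Suc.prems(1)]
          Ck_on_Suc_derivative[OF Suc.prems(2)])
  next
    fix v
    show "Ck_on k S (\<lambda>x. f x * frechet_derivative g (at x) v + frechet_derivative f (at x) v * g x)"
      using Suc.prems Ck_on_SucD[OF Suc.prems(1)] Ck_on_SucD[OF Suc.prems(2)]
      by (intro Ck_on_add assms(1) Suc.IH) auto
  qed
qed (auto intro: continuous_intros)

lemma Ck_on_bounded_linear: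
  assumes "open S" "bounded_linear L" "Ck_on k S f"
  shows "Ck_on k S (\<lambda>x. L (f x))"
  using assms(3)
proof (induction k arbitrary: f)
  case 0
  then show ?case by (simp add: bounded_linear.continuous_on[OF assms(2)])
next
  case (Suc k)
  show ?case
    by (rule Ck_on_SucI[OF assms(1) bounded_linear.has_derivative[OF assms(2)]])
      (use Ck_on_Suc_derivative[OF Suc.prems] Suc in auto)
qed

text \<open>The directional derivatives of \<open>g \<circ> f\<close> are sums of products of components of
  directional derivatives of \<open>f\<close> with partial derivatives of \<open>g\<close> composed with \<open>f\<close>; the latter
  are again compositions, of one order less.\<close>

lemma Ck_on_compose:
  fixes f :: "'a::real_normed_vector \<Rightarrow> 'b::euclidean_space" and g :: "'b \<Rightarrow> real"
  assumes "open S" "open T" "f ` S \<subseteq> T" "Ck_on k S f" "Ck_on k T g"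
  shows "Ck_on k S (g \<circ> f)"
  using assms(4,5)
proof (induction k arbitrary: g)
  case 0
  then show ?case using assms(3) continuous_on_compose continuous_on_subset
    by (metis Ck_on.simps(1))
next
  case (Suc k)
  let ?f' = "\<lambda>x. frechet_derivative f (at x)" and ?g' = "\<lambda>y. frechet_derivative g (at y)"
  show ?case
  proof (rule Ck_on_SucI[OF assms(1)])
    fix x assume x: "x \<in> S"
    then have g: "(g has_derivative ?g' (f x)) (at (f x))"
      using Suc.prems(2) assms(3) Ck_on_Suc_derivative by blast
    have "(g \<circ> f has_derivative ?g' (f x) \<circ> ?f' x) (at x)"
      using Ck_on_Suc_derivative[OF Suc.prems(1) x] g by (rule diff_chain_at)
    moreover have "?g' (f x) (?f' x v) = (\<Sum>b\<in>Basis. (?f' x v \<bullet> b) * ?g' (f x) b)" for v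
    proof -
      have "linear (?g' (f x))" using g has_derivative_linear by blast
      then have "?g' (f x) (\<Sum>b\<in>Basis. (?f' x v \<bullet> b) *\<^sub>R b)
          = (\<Sum>b\<in>Basis. (?f' x v \<bullet> b) * ?g' (f x) b)"
        by (simp add: linear_sum linear_scale)
      then show ?thesis by (simp add: euclidean_representation)
    qed
    ultimately show "(g \<circ> f has_derivative
        (\<lambda>v. \<Sum>b\<in>Basis. (?f' x v \<bullet> b) * ?g' (f x) b)) (at x)"
      by (simp add: comp_def)
  next
    fix v
    have "Ck_on k S (\<lambda>x. (?f' x v \<bullet> b) * ?g' (f x) b)" if "b \<in> Basis" for b
    proof (intro Ck_on_mult assms(1))
      show "Ck_on k S (\<lambda>x. ?f' x v \<bullet> b)"
        using Suc.prems(1) by (intro Ck_on_bounded_linear[OF assms(1) bounded_linear_inner_left]) simp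
      show "Ck_on k S (\<lambda>x. ?g' (f x) b)"
        using Suc.IH[of "\<lambda>y. ?g' y b"] Ck_on_SucD[OF Suc.prems(1)] Suc.prems(2)
        by (simp add: comp_def)
    qed
    then show "Ck_on k S (\<lambda>x. \<Sum>b\<in>Basis. (?f' x v \<bullet> b) * ?g' (f x) b)"
      by (intro Ck_on_sum assms(1)) auto
  qed
qed

lemma smooth_on_subset: "smooth_on S f \<Longrightarrow> T \<subseteq> S \<Longrightarrow> smooth_on T f"
  unfolding smooth_on_def using Ck_on_subset by blast

lemma smooth_on_cong:
  "open S \<Longrightarrow> smooth_on S f \<Longrightarrow> (\<And>x. x \<in> S \<Longrightarrow> f x = g x) \<Longrightarrow> smooth_on S g"
  unfolding smooth_on_def using Ck_on_cong by blast

lemma smooth_on_compose: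
  fixes f :: "'a::real_normed_vector \<Rightarrow> 'b::euclidean_space" and g :: "'b \<Rightarrow> real"
  assumes "open S" "open T" "f ` S \<subseteq> T" "smooth_on S f" "smooth_on T g"
  shows "smooth_on S (g \<circ> f)"
  using assms Ck_on_compose unfolding smooth_on_def by blast

lemma smooth_on_derivative:
  "smooth_on S f \<Longrightarrow> smooth_on S (\<lambda>x. frechet_derivative f (at x) v)"
  unfolding smooth_on_def by (metis Ck_on.simps(2))

lemma smooth_on_imp_has_derivative:
  "smooth_on S f \<Longrightarrow> x \<in> S \<Longrightarrow> (f has_derivative frechet_derivative f (at x)) (at x)"
  unfolding smooth_on_def using Ck_on_Suc_derivative by blast

section \<open>Smooth functions on manifolds\<close>

context
  fixes M :: "('a, 'k::finite) mfd"
  assumes M: "smooth_manifold M"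
begin

lemma chart_exists: "p \<in> pts M \<Longrightarrow> \<exists>c\<in>atlas M. p \<in> dom_c c"
  using M unfolding smooth_manifold_def by blast

lemma chart_at: assumes "p \<in> pts M" shows "chart_at M p \<in> atlas M" "p \<in> dom_c (chart_at M p)"
proof -
  have "chart_at M p \<in> atlas M \<and> p \<in> dom_c (chart_at M p)"
    unfolding chart_at_def by (rule someI_ex) (use chart_exists[OF assms] in blast)
  then show "chart_at M p \<in> atlas M" "p \<in> dom_c (chart_at M p)" by auto
qed

lemma openin_dom: "c \<in> atlas M \<Longrightarrow> openin (topo M) (dom_c c)"
  using M unfolding smooth_manifold_def by blast

lemma dom_subset_pts: "c \<in> atlas M \<Longrightarrow> dom_c c \<subseteq> pts M"
  using openin_dom openin_subset by blast

lemma inj_on_chart: assumes "c \<in> atlas M" shows "inj_on (map_c c) (dom_c c)"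
proof -
  have "homeomorphic_map (subtopology (topo M) (dom_c c))
          (top_of_set (map_c c ` dom_c c)) (map_c c)"
    using M assms unfolding smooth_manifold_def by blast
  then have "inj_on (map_c c) (topspace (subtopology (topo M) (dom_c c)))"
    using homeomorphic_imp_injective_map by blast
  moreover have "topspace (subtopology (topo M) (dom_c c)) = dom_c c"
    using dom_subset_pts[OF assms] by auto
  ultimately show ?thesis by simp
qed

lemma inv_c_map_c: "c \<in> atlas M \<Longrightarrow> p \<in> dom_c c \<Longrightarrow> inv_c c (map_c c p) = p"
  unfolding inv_c_def by (simp add: inj_on_chart)

lemma open_chart_image:
  assumes "c \<in> atlas M" "openin (topo M) U"
  shows "open (map_c c ` (dom_c c \<inter> U))"
proof -
  have hm: "homeomorphic_map (subtopology (topo M) (dom_c c))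
          (top_of_set (map_c c ` dom_c c)) (map_c c)"
    and op: "open (map_c c ` dom_c c)"
    using M assms unfolding smooth_manifold_def by blast+
  have "openin (subtopology (topo M) (dom_c c)) (dom_c c \<inter> U)"
    using assms(2) by (simp add: inf_commute openin_subtopology_Int)
  moreover have "dom_c c \<inter> U \<subseteq> topspace (subtopology (topo M) (dom_c c))"
    using dom_subset_pts[OF assms(1)] by auto
  ultimately have "openin (top_of_set (map_c c ` dom_c c)) (map_c c ` (dom_c c \<inter> U))"
    using homeomorphic_map_openness_eq[OF hm] by blast
  then show ?thesis using op by (simp add: openin_open_eq)
qed

lemma smooth_transition:
  "c \<in> atlas M \<Longrightarrow> d \<in> atlas M \<Longrightarrow> smooth_on (map_c c ` (dom_c c \<inter> dom_c d)) (map_c d \<circ> inv_c c)"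
  using M unfolding smooth_manifold_def by blast

lemma smooth_fun_on_subset: "smooth_fun_on M U \<phi> \<Longrightarrow> W \<subseteq> U \<Longrightarrow> smooth_fun_on M W \<phi>"
  unfolding smooth_fun_on_def by (meson smooth_on_subset image_mono Int_mono order_refl)

lemma smooth_fun_on_cong:
  assumes "openin (topo M) U" "smooth_fun_on M U \<phi>" "\<And>q. q \<in> U \<Longrightarrow> \<phi> q = \<psi> q"
  shows "smooth_fun_on M U \<psi>"
  unfolding smooth_fun_on_def
proof
  fix c assume c: "c \<in> atlas M"
  show "smooth_on (map_c c ` (dom_c c \<inter> U)) (\<psi> \<circ> inv_c c)"
    by (rule smooth_on_cong[OF open_chart_image[OF c assms(1)], of "\<phi> \<circ> inv_c c"])
      (use assms c inv_c_map_c[OF c] in \<open>auto simp: smooth_fun_on_def\<close>)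
qed

lemma smooth_fun_on_const: "openin (topo M) U \<Longrightarrow> smooth_fun_on M U (\<lambda>_. a)"
  unfolding smooth_fun_on_def smooth_on_def comp_def using Ck_on_const open_chart_image by blast

lemma smooth_fun_on_add:
  "openin (topo M) U \<Longrightarrow> smooth_fun_on M U \<phi> \<Longrightarrow> smooth_fun_on M U \<psi>
    \<Longrightarrow> smooth_fun_on M U (\<lambda>q. \<phi> q + \<psi> q)"
  unfolding smooth_fun_on_def smooth_on_def comp_def using Ck_on_add open_chart_image by blast

lemma smooth_fun_on_mult:
  "openin (topo M) U \<Longrightarrow> smooth_fun_on M U \<phi> \<Longrightarrow> smooth_fun_on M U \<psi>
    \<Longrightarrow> smooth_fun_on M U (\<lambda>q. \<phi> q * \<psi> q)"
  unfolding smooth_fun_on_def smooth_on_def comp_def using Ck_on_mult open_chart_image by blast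

lemma smooth_near_pair:
  assumes "smooth_near M p \<phi>" "smooth_near M p \<psi>"
  obtains U where "openin (topo M) U" "p \<in> U" "smooth_fun_on M U \<phi>" "smooth_fun_on M U \<psi>"
proof -
  obtain U W where "openin (topo M) U" "p \<in> U" "smooth_fun_on M U \<phi>"
    "openin (topo M) W" "p \<in> W" "smooth_fun_on M W \<psi>"
    using assms unfolding smooth_near_def by blast
  then show ?thesis
    by (intro that[of "U \<inter> W"]) (auto intro: smooth_fun_on_subset)
qed

lemma smooth_near_add:
  "smooth_near M p \<phi> \<Longrightarrow> smooth_near M p \<psi> \<Longrightarrow> smooth_near M p (\<lambda>q. \<phi> q + \<psi> q)"
  by (erule smooth_near_pair, assumption) (auto simp: smooth_near_def intro: smooth_fun_on_add)

lemma smooth_near_mult: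
  "smooth_near M p \<phi> \<Longrightarrow> smooth_near M p \<psi> \<Longrightarrow> smooth_near M p (\<lambda>q. \<phi> q * \<psi> q)"
  by (erule smooth_near_pair, assumption) (auto simp: smooth_near_def intro: smooth_fun_on_mult)

lemma smooth_near_const: "p \<in> pts M \<Longrightarrow> smooth_near M p (\<lambda>_. a)"
  unfolding smooth_near_def using smooth_fun_on_const openin_topspace by blast

lemma smooth_near_scale: "p \<in> pts M \<Longrightarrow> smooth_near M p \<phi> \<Longrightarrow> smooth_near M p (\<lambda>q. a * \<phi> q)"
  using smooth_near_mult[OF smooth_near_const] by blast

lemma smooth_fun_on_coord:
  assumes "d \<in> atlas M" shows "smooth_fun_on M (dom_c d) (coord d k)"
  unfolding smooth_fun_on_def
proof
  fix c assume c: "c \<in> atlas M"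
  have "smooth_on (map_c c ` (dom_c c \<inter> dom_c d)) (\<lambda>x. (map_c d \<circ> inv_c c) x $ k)"
    using smooth_transition[OF c assms] open_chart_image[OF c openin_dom[OF assms]]
      Ck_on_bounded_linear[OF _ bounded_linear_vec_nth] unfolding smooth_on_def by blast
  then show "smooth_on (map_c c ` (dom_c c \<inter> dom_c d)) (coord d k \<circ> inv_c c)"
    by (simp add: coord_def comp_def)
qed

section \<open>Tangent vectors\<close>

lemma tangent_space_zero: "(\<lambda>_. 0) \<in> tangent_space M p"
  unfolding tangent_space_def by auto

lemma tangent_space_lin:
  "X \<in> tangent_space M p \<Longrightarrow> Y \<in> tangent_space M p \<Longrightarrow> (\<lambda>\<phi>. a * X \<phi> + b * Y \<phi>) \<in> tangent_space M p"
  unfolding tangent_space_def by (auto simp: algebra_simps)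

lemma tangent_space_sum:
  assumes "finite I" "\<And>i. i \<in> I \<Longrightarrow> X i \<in> tangent_space M p"
  shows "(\<lambda>\<phi>. \<Sum>i\<in>I. X i \<phi>) \<in> tangent_space M p"
  using assms
proof (induction I rule: finite_induct)
  case (insert i I)
  then show ?case
    using tangent_space_lin[of "X i" p "\<lambda>\<phi>. \<Sum>i\<in>I. X i \<phi>" 1 1] by simp
qed (simp add: tangent_space_zero)

lemma tangent_const:
  assumes "X \<in> tangent_space M p" "p \<in> pts M" shows "X (\<lambda>_. a) = 0"
proof -
  have "X (\<lambda>_. 1 * 1) = X (\<lambda>_. 1) * 1 + 1 * X (\<lambda>_. 1)" "X (\<lambda>_. a * 1) = a * X (\<lambda>_. 1)"
    using assms(1) smooth_near_const[OF assms(2), of 1] unfolding tangent_space_def by blast+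
  then show ?thesis by simp
qed

lemma coord_vec_tangent:
  assumes c: "c \<in> atlas M" and p: "p \<in> dom_c c"
  shows "coord_vec M c k p \<in> tangent_space M p"
proof -
  let ?D = "\<lambda>\<phi> :: 'a \<Rightarrow> real. frechet_derivative (\<phi> \<circ> inv_c c) (at (map_c c p))"
  have pM: "p \<in> pts M" using dom_subset_pts[OF c] p by (rule subsetD)
  have der: "(\<phi> \<circ> inv_c c has_derivative ?D \<phi>) (at (map_c c p))" if \<phi>: "smooth_near M p \<phi>" for \<phi>
  proof -
    obtain U where U: "p \<in> U" "smooth_fun_on M U \<phi>"
      using \<phi> unfolding smooth_near_def by blast
    have "smooth_on (map_c c ` (dom_c c \<inter> U)) (\<phi> \<circ> inv_c c)"
      using U(2) c unfolding smooth_fun_on_def by (rule bspec)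
    moreover have "map_c c p \<in> map_c c ` (dom_c c \<inter> U)" using p U(1) by (intro imageI IntI)
    ultimately show ?thesis by (rule smooth_on_imp_has_derivative)
  qed
  have add: "?D (\<lambda>q. \<phi> q + \<psi> q) v = ?D \<phi> v + ?D \<psi> v"
    and mult: "?D (\<lambda>q. \<phi> q * \<psi> q) v = ?D \<phi> v * \<psi> p + \<phi> p * ?D \<psi> v"
    if s: "smooth_near M p \<phi>" "smooth_near M p \<psi>" for \<phi> \<psi> v
  proof -
    have "((\<lambda>q. \<phi> q + \<psi> q) \<circ> inv_c c has_derivative (\<lambda>v. ?D \<phi> v + ?D \<psi> v)) (at (map_c c p))"
      using has_derivative_add[OF der[OF s(1)] der[OF s(2)]] by (simp add: comp_def)
    from frechet_derivative_at[OF this, symmetric]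
    show "?D (\<lambda>q. \<phi> q + \<psi> q) v = ?D \<phi> v + ?D \<psi> v" by (rule fun_cong)
    have "((\<lambda>q. \<phi> q * \<psi> q) \<circ> inv_c c has_derivative (\<lambda>v. \<phi> p * ?D \<psi> v + ?D \<phi> v * \<psi> p))
        (at (map_c c p))"
      using has_derivative_mult[OF der[OF s(1)] der[OF s(2)]]
      by (simp add: comp_def inv_c_map_c[OF c p])
    from fun_cong[OF frechet_derivative_at[OF this, symmetric], of v]
    show "?D (\<lambda>q. \<phi> q * \<psi> q) v = ?D \<phi> v * \<psi> p + \<phi> p * ?D \<psi> v" by simp
  qed
  have scale: "?D (\<lambda>q. a * \<phi> q) v = a * ?D \<phi> v" if s: "smooth_near M p \<phi>" for \<phi> a v
  proof -
    have "((\<lambda>q. a * \<phi> q) \<circ> inv_c c has_derivative (\<lambda>v. a * ?D \<phi> v)) (at (map_c c p))"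
      using has_derivative_mult_right[OF der[OF s]] by (simp add: comp_def)
    from frechet_derivative_at[OF this, symmetric] show ?thesis by (rule fun_cong)
  qed
  show ?thesis
    unfolding tangent_space_def coord_vec_def
    using smooth_near_add smooth_near_mult smooth_near_scale[OF pM] add mult scale by simp
qed

text \<open>In the chart \<open>c\<close>, the \<open>j\<close>-th \<open>d'\<close>-component of the coordinate field \<open>\<partial>\<^sub>k\<close> of \<open>d\<close> is an
  entry of the Jacobian of the transition map from \<open>d\<close> to \<open>d'\<close>, composed with the transition map
  from \<open>c\<close> to \<open>d\<close>.\<close>

lemma coord_vec_coord_smooth:
  assumes d: "d \<in> atlas M" and d': "d' \<in> atlas M"
  shows "smooth_fun_on M (dom_c d \<inter> dom_c d') (\<lambda>p. coord_vec M d k p (coord d' j))"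
proof -
  let ?W = "dom_c d \<inter> dom_c d'"
  let ?G = "\<lambda>y. frechet_derivative (coord d' j \<circ> inv_c d) (at y) (axis k 1)"
  have W: "openin (topo M) ?W" using openin_dom[OF d] openin_dom[OF d'] by blast
  have G: "smooth_on (map_c d ` ?W) ?G"
    using smooth_fun_on_coord[OF d'] d unfolding smooth_fun_on_def
    by (intro smooth_on_derivative) blast
  have "smooth_fun_on M ?W (\<lambda>p. ?G (map_c d p))"
    unfolding smooth_fun_on_def
  proof
    fix c assume c: "c \<in> atlas M"
    have "smooth_on (map_c c ` (dom_c c \<inter> ?W)) (?G \<circ> (map_c d \<circ> inv_c c))"
    proof (rule smooth_on_compose[OF _ _ _ _ G])
      show "open (map_c c ` (dom_c c \<inter> ?W))" using open_chart_image[OF c W] .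
      show "open (map_c d ` ?W)" using open_chart_image[OF d openin_dom[OF d']] .
      show "(map_c d \<circ> inv_c c) ` map_c c ` (dom_c c \<inter> ?W) \<subseteq> map_c d ` ?W"
        using inv_c_map_c[OF c] by auto
      show "smooth_on (map_c c ` (dom_c c \<inter> ?W)) (map_c d \<circ> inv_c c)"
        using smooth_transition[OF c d] by (rule smooth_on_subset) auto
    qed
    then show "smooth_on (map_c c ` (dom_c c \<inter> ?W)) ((\<lambda>p. ?G (map_c d p)) \<circ> inv_c c)"
      by (simp add: comp_def)
  qed
  then show ?thesis
  proof (rule smooth_fun_on_cong[OF W])
    fix q assume "q \<in> ?W"
    then have "smooth_near M q (coord d' j)"
      using smooth_fun_on_coord[OF d'] openin_dom[OF d'] unfolding smooth_near_def by blast
    then show "?G (map_c d q) = coord_vec M d k q (coord d' j)" by (simp add: coord_vec_def)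
  qed
qed

lemma smooth_field_onI:
  assumes "\<And>p. p \<in> U \<Longrightarrow> X p \<in> tangent_space M p"
    and "\<And>d k. d \<in> atlas M \<Longrightarrow> smooth_fun_on M (U \<inter> dom_c d) (\<lambda>p. X p (coord d k))"
  shows "smooth_field_on M U X"
  using assms unfolding smooth_field_on_def smooth_field_along_on_def by (simp add: Int_def)

lemma smooth_field_onD:
  assumes "smooth_field_on M U X"
  shows "p \<in> U \<Longrightarrow> X p \<in> tangent_space M p"
    and "d \<in> atlas M \<Longrightarrow> smooth_fun_on M (U \<inter> dom_c d) (\<lambda>p. X p (coord d k))"
  using assms unfolding smooth_field_on_def smooth_field_along_on_def by (simp_all add: Int_def)

lemma smooth_field_on_coord_vec:
  "d \<in> atlas M \<Longrightarrow> smooth_field_on M (dom_c d) (coord_vec M d k)"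
  by (intro smooth_field_onI coord_vec_tangent coord_vec_coord_smooth)

lemma smooth_field_on_zero:
  assumes U: "openin (topo M) U" and Z: "\<And>q. q \<in> U \<Longrightarrow> Z q = (\<lambda>_. 0)"
  shows "smooth_field_on M U Z"
proof (rule smooth_field_onI)
  show "Z p \<in> tangent_space M p" if "p \<in> U" for p using that Z tangent_space_zero by simp
  show "smooth_fun_on M (U \<inter> dom_c d) (\<lambda>p. Z p (coord d k))" if "d \<in> atlas M" for d k
    by (rule smooth_fun_on_cong[OF _ smooth_fun_on_const[of _ 0]])
      (use U Z openin_dom[OF that] in auto)
qed

lemma smooth_field_on_lin:
  assumes U: "openin (topo M) U" and X: "smooth_field_on M U X" and Y: "smooth_field_on M U Y"
  shows "smooth_field_on M U (\<lambda>r \<phi>. a * X r \<phi> + b * Y r \<phi>)"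
proof (rule smooth_field_onI)
  show "(\<lambda>\<phi>. a * X p \<phi> + b * Y p \<phi>) \<in> tangent_space M p" if "p \<in> U" for p
    by (intro tangent_space_lin smooth_field_onD(1)[OF X] smooth_field_onD(1)[OF Y] that)
  show "smooth_fun_on M (U \<inter> dom_c d) (\<lambda>p. a * X p (coord d k) + b * Y p (coord d k))"
    if "d \<in> atlas M" for d k
    by (intro smooth_fun_on_add smooth_fun_on_mult smooth_fun_on_const openin_Int U openin_dom that
        smooth_field_onD(2)[OF X] smooth_field_onD(2)[OF Y])
qed

lemma smooth_field_on_extend_const:
  assumes "d \<in> atlas M" shows "smooth_field_on M (dom_c d) (extend_const M d u)"
proof -
  have "smooth_field_on M (dom_c d) (\<lambda>q \<phi>. \<Sum>k\<in>K. u (coord d k) * coord_vec M d k q \<phi>)"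
    if "finite K" for K
    using that
  proof (induction K rule: finite_induct)
    case empty
    then show ?case by (simp add: smooth_field_on_zero openin_dom[OF assms])
  next
    case (insert k K)
    then show ?case
      using smooth_field_on_lin[OF openin_dom[OF assms] smooth_field_on_coord_vec[OF assms] insert.IH,
          of "u (coord d k)" k 1] by simp
  qed
  from this[of UNIV] show ?thesis by (simp add: extend_const_def[abs_def] lincomb_def)
qed

end

text \<open>With a chart \<open>d\<close> around \<open>f p\<close>, the function \<open>\<phi> \<circ> f\<close> is, in a chart \<open>c\<close> of \<open>M\<close>, the
  composition of the coordinate expression \<open>d \<circ> f \<circ> c\<^sup>-\<^sup>1\<close> of \<open>f\<close> with the coordinate expression
  \<open>\<phi> \<circ> d\<^sup>-\<^sup>1\<close> of \<open>\<phi>\<close>.\<close>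

lemma smooth_near_pullback:
  assumes M: "smooth_manifold M" and N: "smooth_manifold N" and f: "smooth_map M N f"
    and p: "p \<in> pts M" and \<phi>: "smooth_near N (f p) \<phi>"
  shows "smooth_near M p (\<phi> \<circ> f)"
proof -
  obtain U where U: "openin (topo N) U" "f p \<in> U" "smooth_fun_on N U \<phi>"
    using \<phi> unfolding smooth_near_def by blast
  have fc: "continuous_map (topo M) (topo N) f" using f unfolding smooth_map_def by blast
  have "f p \<in> pts N" using U openin_subset by blast
  then obtain d where d: "d \<in> atlas N" "f p \<in> dom_c d" using chart_exists[OF N] by blast
  let ?W = "{q \<in> pts M. f q \<in> U \<inter> dom_c d}"
  have W: "openin (topo M) ?W"
    using openin_continuous_map_preimage[OF fc] U(1) openin_dom[OF N d(1)] by blast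
  have "smooth_on (map_c c ` (dom_c c \<inter> ?W)) ((\<phi> \<circ> f) \<circ> inv_c c)" if c: "c \<in> atlas M" for c
  proof (rule smooth_on_cong)
    show "smooth_on (map_c c ` (dom_c c \<inter> ?W)) ((\<phi> \<circ> inv_c d) \<circ> (map_c d \<circ> f \<circ> inv_c c))"
    proof (rule smooth_on_compose)
      show "open (map_c c ` (dom_c c \<inter> ?W))" using open_chart_image[OF M c W] .
      show "open (map_c d ` (dom_c d \<inter> U))" using open_chart_image[OF N d(1) U(1)] .
      show "(map_c d \<circ> f \<circ> inv_c c) ` map_c c ` (dom_c c \<inter> ?W) \<subseteq> map_c d ` (dom_c d \<inter> U)"
        using inv_c_map_c[OF M c] by auto
      have "smooth_on (map_c c ` {p \<in> dom_c c. f p \<in> dom_c d}) (map_c d \<circ> f \<circ> inv_c c)"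
        using f c d(1) unfolding smooth_map_def by blast
      then show "smooth_on (map_c c ` (dom_c c \<inter> ?W)) (map_c d \<circ> f \<circ> inv_c c)"
        by (rule smooth_on_subset) auto
      show "smooth_on (map_c d ` (dom_c d \<inter> U)) (\<phi> \<circ> inv_c d)"
        using U(3) d(1) unfolding smooth_fun_on_def by blast
    qed
    show "open (map_c c ` (dom_c c \<inter> ?W))" using open_chart_image[OF M c W] .
    fix x assume "x \<in> map_c c ` (dom_c c \<inter> ?W)"
    then show "((\<phi> \<circ> inv_c d) \<circ> (map_c d \<circ> f \<circ> inv_c c)) x = ((\<phi> \<circ> f) \<circ> inv_c c) x"
      using inv_c_map_c[OF M c] inv_c_map_c[OF N d(1)] by auto
  qed
  then have "smooth_fun_on M ?W (\<phi> \<circ> f)" unfolding smooth_fun_on_def by blast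
  then show ?thesis using W p U(2) d(2) unfolding smooth_near_def by blast
qed

lemma push_tangent:
  assumes M: "smooth_manifold M" and N: "smooth_manifold N" and f: "smooth_map M N f"
    and p: "p \<in> pts M" and X: "X \<in> tangent_space M p"
  shows "push N f p X \<in> tangent_space N (f p)"
proof -
  have fp: "f p \<in> pts N"
    using f p unfolding smooth_map_def continuous_map_def by blast
  have X': "X (\<lambda>q. \<phi> q + \<psi> q) = X \<phi> + X \<psi>" "X (\<lambda>q. \<phi> q * \<psi> q) = X \<phi> * \<psi> p + \<phi> p * X \<psi>"
    "X (\<lambda>q. a * \<phi> q) = a * X \<phi>"
    if "smooth_near M p \<phi>" "smooth_near M p \<psi>" for \<phi> \<psi> a
    using X that unfolding tangent_space_def by blast+
  note pb = smooth_near_pullback[OF M N f p]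
  show ?thesis
    unfolding tangent_space_def push_def
    using smooth_near_add[OF N] smooth_near_mult[OF N] smooth_near_scale[OF N fp]
      X'[OF pb pb] by (simp add: comp_def)
qed

section \<open>Inner products and orthonormal frames\<close>

text \<open>Tangent vectors at a point form a set of functions, not a type, so an inner product on a
  tangent space is bilinear and positive only relative to that set.\<close>

locale tvec_inner_product =
  fixes T :: "'a tvec set" and ip :: "'a tvec \<Rightarrow> 'a tvec \<Rightarrow> real"
  assumes zero_mem: "(\<lambda>_. 0) \<in> T"
    and lin_mem: "X \<in> T \<Longrightarrow> Y \<in> T \<Longrightarrow> (\<lambda>\<phi>. a * X \<phi> + b * Y \<phi>) \<in> T"
    and ip_sym: "X \<in> T \<Longrightarrow> Y \<in> T \<Longrightarrow> ip X Y = ip Y X"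
    and ip_lin: "X \<in> T \<Longrightarrow> Y \<in> T \<Longrightarrow> Z \<in> T \<Longrightarrow>
      ip (\<lambda>\<phi>. a * X \<phi> + b * Y \<phi>) Z = a * ip X Z + b * ip Y Z"
    and ip_pos: "X \<in> T \<Longrightarrow> X \<noteq> (\<lambda>_. 0) \<Longrightarrow> 0 < ip X X"
begin

lemma ip_lin_right:
  assumes "X \<in> T" "Y \<in> T" "Z \<in> T"
  shows "ip Z (\<lambda>\<phi>. a * X \<phi> + b * Y \<phi>) = a * ip Z X + b * ip Z Y"
  using ip_sym[OF assms(3) lin_mem[OF assms(1,2), of a b]] ip_lin[OF assms, of a b]
    ip_sym[OF assms(1,3)] ip_sym[OF assms(2,3)] by simp

lemma ip_zero: "X \<in> T \<Longrightarrow> ip (\<lambda>_. 0) X = 0"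
  using ip_lin[of X X X 0 0] by simp

lemma ip_nonneg: "X \<in> T \<Longrightarrow> 0 \<le> ip X X"
  using ip_pos[of X] ip_zero[of X] by fastforce

text \<open>The vector \<open>\<langle>Y,Y\<rangle> X - \<langle>X,Y\<rangle> Y\<close> is nonzero, and its square is the Gram determinant
  times \<open>\<langle>Y,Y\<rangle>\<close>.\<close>

lemma gram_determinant_pos:
  assumes X: "X \<in> T" and Y: "Y \<in> T"
    and indep: "\<And>a b. (\<lambda>\<phi>. a * X \<phi> + b * Y \<phi>) = (\<lambda>_. 0) \<Longrightarrow> a = 0 \<and> b = 0"
  shows "0 < ip X X * ip Y Y - (ip X Y)\<^sup>2"
proof -
  have "Y \<noteq> (\<lambda>_. 0)" using indep[of 0 1] by auto
  then have Y0: "0 < ip Y Y" using ip_pos Y by blast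
  let ?Z = "\<lambda>\<phi>. ip Y Y * X \<phi> + (- ip X Y) * Y \<phi>"
  have Z: "?Z \<in> T" by (rule lin_mem[OF X Y])
  have "?Z \<noteq> (\<lambda>_. 0)" using indep[of "ip Y Y" "- ip X Y"] Y0 by auto
  then have "0 < ip ?Z ?Z" using ip_pos Z by blast
  also have "ip ?Z ?Z = ip Y Y * (ip X X * ip Y Y - (ip X Y)\<^sup>2)"
    unfolding ip_lin[OF X Y Z] ip_lin_right[OF X Y X] ip_lin_right[OF X Y Y] ip_sym[OF Y X]
    by (simp add: power2_eq_square algebra_simps)
  finally show ?thesis using Y0 by (simp add: zero_less_mult_iff)
qed

lemma lincomb_mem_ip:
  assumes "finite I" "\<And>i. i \<in> I \<Longrightarrow> X i \<in> T"
  shows "lincomb I a X \<in> T" and "Z \<in> T \<Longrightarrow> ip (lincomb I a X) Z = (\<Sum>i\<in>I. a i * ip (X i) Z)"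
  using assms
proof (induction I rule: finite_induct)
  case empty
  case 1 then show ?case by (simp add: lincomb_def zero_mem)
  case 2 then show ?case by (simp add: lincomb_def ip_zero)
next
  case (insert i I)
  have eq: "lincomb (insert i I) a X = (\<lambda>\<phi>. a i * X i \<phi> + 1 * lincomb I a X \<phi>)"
    using insert by (simp add: lincomb_def)
  {
    case 1 show ?case unfolding eq by (rule lin_mem) (use insert 1 in auto)
  next
    case 2 
    have "X i \<in> T" "lincomb I a X \<in> T" "ip (lincomb I a X) Z = (\<Sum>i\<in>I. a i * ip (X i) Z)"
      using insert 2 by auto
    then show ?case unfolding eq using ip_lin[of "X i" "lincomb I a X" Z "a i" 1] insert(1,2) 2(1)
      by simp
  }
qed

end

definition span_lt :: "nat \<Rightarrow> (nat \<Rightarrow> 'a tvec) \<Rightarrow> 'a tvec set" where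
  "span_lt m X = range (\<lambda>a. lincomb {..<m} a X)"

lemma span_lt_cong: "(\<And>i. i < m \<Longrightarrow> X i = Y i) \<Longrightarrow> span_lt m X = span_lt m Y"
  unfolding span_lt_def lincomb_def by simp

lemma span_lt_lin:
  assumes "s \<in> span_lt m X" "t \<in> span_lt m X"
  shows "(\<lambda>\<phi>. a * s \<phi> + b * t \<phi>) \<in> span_lt m X"
proof -
  obtain u v where "s = lincomb {..<m} u X" "t = lincomb {..<m} v X"
    using assms unfolding span_lt_def by blast
  then have "(\<lambda>\<phi>. a * s \<phi> + b * t \<phi>) = lincomb {..<m} (\<lambda>i. a * u i + b * v i) X"
    by (simp add: lincomb_def sum_distrib_left sum.distrib algebra_simps)
  then show ?thesis unfolding span_lt_def by blast
qed

lemma span_lt_SucI: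
  assumes "s \<in> span_lt m X" "Y = (\<lambda>\<phi>. s \<phi> + c * X m \<phi>)"
  shows "Y \<in> span_lt (Suc m) X"
proof -
  obtain a where "s = lincomb {..<m} a X" using assms(1) unfolding span_lt_def by blast
  then have "Y = lincomb {..<Suc m} (a(m := c)) X" using assms(2) by (simp add: lincomb_def)
  then show ?thesis unfolding span_lt_def by blast
qed

lemma span_lt_SucE:
  assumes "Y \<in> span_lt (Suc m) X"
  obtains s c where "s \<in> span_lt m X" "Y = (\<lambda>\<phi>. s \<phi> + c * X m \<phi>)"
proof -
  obtain a where "Y = lincomb {..<Suc m} a X" using assms unfolding span_lt_def by blast
  then have "Y = (\<lambda>\<phi>. lincomb {..<m} a X \<phi> + a m * X m \<phi>)" by (simp add: lincomb_def)
  then show ?thesis using that unfolding span_lt_def by blast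
qed

text \<open>Replacing the last vector by a nonzero multiple of itself minus a combination of the others
  does not change the span; this is the step of the Gram-Schmidt process.\<close>

lemma span_lt_exchange:
  assumes s: "s0 \<in> span_lt m X" and eq: "span_lt m Y = span_lt m X" and b: "b \<noteq> 0"
    and Ym: "Y m = (\<lambda>\<phi>. b * (X m \<phi> - s0 \<phi>))"
  shows "span_lt (Suc m) Y = span_lt (Suc m) X"
proof (intro set_eqI iffI)
  fix Z assume "Z \<in> span_lt (Suc m) Y"
  then obtain s c where "s \<in> span_lt m X" and Z: "Z = (\<lambda>\<phi>. s \<phi> + c * Y m \<phi>)"
    unfolding eq[symmetric] by (rule span_lt_SucE)
  then have "(\<lambda>\<phi>. 1 * s \<phi> + (- c * b) * s0 \<phi>) \<in> span_lt m X" using span_lt_lin s by blast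
  moreover have "Z = (\<lambda>\<phi>. (1 * s \<phi> + (- c * b) * s0 \<phi>) + (c * b) * X m \<phi>)"
    unfolding Z Ym by (simp add: algebra_simps)
  ultimately show "Z \<in> span_lt (Suc m) X" by (rule span_lt_SucI)
next
  fix Z assume "Z \<in> span_lt (Suc m) X"
  then obtain s c where "s \<in> span_lt m X" and Z: "Z = (\<lambda>\<phi>. s \<phi> + c * X m \<phi>)"
    by (rule span_lt_SucE)
  then have "(\<lambda>\<phi>. 1 * s \<phi> + c * s0 \<phi>) \<in> span_lt m Y" unfolding eq using span_lt_lin s by blast
  moreover have "Z = (\<lambda>\<phi>. (1 * s \<phi> + c * s0 \<phi>) + (c / b) * Y m \<phi>)"
    unfolding Z Ym using b by (simp add: algebra_simps)
  ultimately show "Z \<in> span_lt (Suc m) Y" by (rule span_lt_SucI)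
qed

lemma (in tvec_inner_product) gram_schmidt:
  assumes "\<And>i. i < m \<Longrightarrow> E i \<in> T"
    and "\<And>a. lincomb {..<m} a E = (\<lambda>_. 0) \<Longrightarrow> \<forall>i<m. a i = 0"
  shows "\<exists>e. (\<forall>i<m. e i \<in> T) \<and> span_lt m e = span_lt m E \<and>
    (\<forall>i<m. \<forall>j<m. ip (e i) (e j) = (if i = j then 1 else 0))"
  using assms
proof (induction m)
  case 0
  show ?case by (intro exI[of _ E]) simp
next
  case (Suc m)
  have "\<forall>i<m. a i = 0" if "lincomb {..<m} a E = (\<lambda>_. 0)" for a
  proof -
    have "lincomb {..<Suc m} (a(m := 0)) E = (\<lambda>_. 0)" using that by (simp add: lincomb_def)
    from Suc.prems(2)[OF this] show ?thesis by (metis fun_upd_other less_SucI less_irrefl)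
  qed
  then obtain e where "\<forall>i<m. e i \<in> T" and sp: "span_lt m e = span_lt m E"
    and "\<forall>i<m. \<forall>j<m. ip (e i) (e j) = (if i = j then 1 else 0)"
    using Suc.IH[OF Suc.prems(1)[OF less_SucI]] by blast
  then have e: "\<And>i. i < m \<Longrightarrow> e i \<in> T"
    and on: "\<And>i j. i < m \<Longrightarrow> j < m \<Longrightarrow> ip (e i) (e j) = (if i = j then 1 else 0)"
    by auto
  define s0 where "s0 = lincomb {..<m} (\<lambda>i. ip (E m) (e i)) e"
  define w where "w = (\<lambda>\<phi>. 1 * E m \<phi> + (-1) * s0 \<phi>)"
  define b where "b = 1 / sqrt (ip w w)"
  \<comment> \<open>the summand \<open>0 * w\<close> brings the vector into the form of \<open>lin_mem\<close> and \<open>ip_lin\<close>\<close>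
  define e' where "e' = e(m := (\<lambda>\<phi>. b * w \<phi> + 0 * w \<phi>))"
  have s0T: "s0 \<in> T" unfolding s0_def using e by (intro lincomb_mem_ip) auto
  have EmT: "E m \<in> T" using Suc.prems(1) by simp
  have wT: "w \<in> T" unfolding w_def by (intro lin_mem EmT s0T)
  have s0span: "s0 \<in> span_lt m E" unfolding sp[symmetric] by (simp add: s0_def span_lt_def)
  have "w \<noteq> (\<lambda>_. 0)"
  proof
    assume "w = (\<lambda>_. 0)"
    then have "w \<phi> = 0" for \<phi> by simp
    then have "E m \<phi> = s0 \<phi>" for \<phi> unfolding w_def by simp
    then have Em: "E m = s0" by blast
    obtain a where a: "s0 = lincomb {..<m} a E" using s0span unfolding span_lt_def by blast
    have "lincomb {..<Suc m} (a(m := -1)) E = (\<lambda>\<phi>. lincomb {..<m} a E \<phi> - E m \<phi>)"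
      by (simp add: lincomb_def)
    also have "\<dots> = (\<lambda>_. 0)" using Em a by simp
    finally have "\<forall>i<Suc m. (a(m := -1)) i = 0" by (rule Suc.prems(2))
    then show False by auto
  qed
  then have w0: "0 < ip w w" using ip_pos wT by blast
  have b0: "b \<noteq> 0" and bb: "b * (b * ip w w) = 1" using w0 by (auto simp: b_def field_simps)
  \<comment> \<open>subtracting the projection \<open>s0\<close> onto the span of the earlier vectors makes \<open>w\<close> orthogonal to them\<close>
  have we: "ip w (e j) = 0" if j: "j < m" for j
  proof -
    have "ip s0 (e j) = (\<Sum>i<m. ip (E m) (e i) * ip (e i) (e j))"
      unfolding s0_def using e j by (intro lincomb_mem_ip) auto
    also have "\<dots> = (\<Sum>i<m. if i = j then ip (E m) (e i) else 0)"
      using on j by (intro sum.cong) auto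
    also have "\<dots> = ip (E m) (e j)" using j by simp
    finally show ?thesis unfolding w_def using ip_lin[OF EmT s0T e[OF j], of 1 "-1"] by simp
  qed
  have emT: "e' m \<in> T" unfolding e'_def using lin_mem[OF wT wT, of b 0] by simp
  have sc: "ip (e' m) Z = b * ip w Z" if "Z \<in> T" for Z
    unfolding e'_def using ip_lin[OF wT wT that, of b 0] by simp
  have eT: "e' i \<in> T" if "i < Suc m" for i
    using that e emT unfolding e'_def by (cases "i = m") auto
  have 1: "ip (e' m) (e' m) = 1"
  proof -
    have "ip w (e' m) = b * ip w w" using sc[OF wT] ip_sym[OF wT emT] by simp
    then show ?thesis using sc[OF emT] bb by simp
  qed
  have 2: "ip (e' m) (e j) = 0" "ip (e j) (e' m) = 0" if "j < m" for j
    using sc[OF e[OF that]] we[OF that] ip_sym[OF emT e[OF that]] by auto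
  have 3: "e' j = e j" if "j < m" for j using that by (simp add: e'_def)
  have "\<forall>i<Suc m. \<forall>j<Suc m. ip (e' i) (e' j) = (if i = j then 1 else 0)"
    using 1 2 3 on by (auto simp: less_Suc_eq)
  moreover have "span_lt (Suc m) e' = span_lt (Suc m) E"
  proof (rule span_lt_exchange[OF s0span _ b0])
    show "span_lt m e' = span_lt m E" using span_lt_cong[of m e' e] 3 sp by simp
    show "e' m = (\<lambda>\<phi>. b * (E m \<phi> - s0 \<phi>))" by (simp add: e'_def w_def)
  qed
  ultimately show ?case using eT by blast
qed

lemma riemannian_tvec_inner_product:
  assumes "riemannian_manifold M g" "p \<in> pts M"
  shows "tvec_inner_product (tangent_space M p) (g p)"
proof -
  have M: "smooth_manifold M" and g: "riemannian_metric M g"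
    using assms(1) unfolding riemannian_manifold_def by auto
  show ?thesis
  proof
    show "(\<lambda>_. 0) \<in> tangent_space M p" by (rule tangent_space_zero[OF M])
    show "(\<lambda>\<phi>. a * X \<phi> + b * Y \<phi>) \<in> tangent_space M p"
      if "X \<in> tangent_space M p" "Y \<in> tangent_space M p" for X Y a b
      using tangent_space_lin[OF M that] .
  qed (use g assms(2) in \<open>simp_all add: riemannian_metric_def\<close>)
qed

text \<open>A frame chosen by \<open>SOME\<close> is orthonormal as soon as an orthonormal frame exists, which
  Gram-Schmidt extracts from a local frame of the subbundle.\<close>

lemma frame_orthonormal:
  assumes "sub_riemannian_manifold M g m H" "p \<in> pts M"
  shows "orthonormal_frame_at g m H p (frame g m H p)"
    and "\<And>i. i < m \<Longrightarrow> frame g m H p i \<in> tangent_space M p"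
proof -
  have R: "riemannian_manifold M g" and B: "smooth_subbundle M m H"
    using assms(1) unfolding sub_riemannian_manifold_def by auto
  have M: "smooth_manifold M" using R unfolding riemannian_manifold_def by blast
  interpret tvec_inner_product "tangent_space M p" "g p"
    by (rule riemannian_tvec_inner_product[OF R assms(2)])
  obtain U E where "p \<in> U" and U: "\<forall>i<m. smooth_field_on M U (E i)"
    and E: "\<forall>q\<in>U. (\<forall>a. lincomb {..<m} a (\<lambda>i. E i q) = (\<lambda>_. 0) \<longrightarrow> (\<forall>i<m. a i = 0)) \<and>
               H q = range (\<lambda>a. lincomb {..<m} a (\<lambda>i. E i q))"
    using B[unfolded smooth_subbundle_def, rule_format, OF assms(2)] by (elim exE conjE)
  have ET: "E i p \<in> tangent_space M p" if "i < m" for i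
    using smooth_field_onD(1)[OF M] U \<open>p \<in> U\<close> that by blast
  have Hp: "H p = span_lt m (\<lambda>i. E i p)" using E \<open>p \<in> U\<close> unfolding span_lt_def by blast
  have "\<exists>e. (\<forall>i<m. e i \<in> tangent_space M p) \<and> span_lt m e = span_lt m (\<lambda>i. E i p) \<and>
    (\<forall>i<m. \<forall>j<m. g p (e i) (e j) = (if i = j then 1 else 0))"
    by (rule gram_schmidt) (use ET E \<open>p \<in> U\<close> in auto)
  then obtain e where e: "span_lt m e = H p"
    and on: "\<forall>i<m. \<forall>j<m. g p (e i) (e j) = (if i = j then 1 else 0)"
    unfolding Hp by blast
  have "e i \<in> span_lt m e" if "i < m" for i
  proof -
    have "e i = lincomb {..<m} (\<lambda>j. if j = i then 1 else 0) e"
      using that by (simp add: lincomb_def if_distrib[of "\<lambda>c. c * _"] cong: if_cong)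
    then show ?thesis unfolding span_lt_def by blast
  qed
  then have "orthonormal_frame_at g m H p e"
    unfolding orthonormal_frame_at_def using e on unfolding span_lt_def by blast
  then show fr: "orthonormal_frame_at g m H p (frame g m H p)"
    unfolding frame_def by (rule someI[of "orthonormal_frame_at g m H p"])
  fix i assume "i < m"
  then have "frame g m H p i \<in> H p" using fr unfolding orthonormal_frame_at_def by blast
  then obtain a where "frame g m H p i = lincomb {..<m} a (\<lambda>i. E i p)"
    unfolding Hp span_lt_def by blast
  then show "frame g m H p i \<in> tangent_space M p" using lincomb_mem_ip(1)[of "{..<m}"] ET by simp
qed

section \<open>Connections and curvature\<close>

context
  fixes N :: "('b, 'n::finite) mfd" and D :: "'b connection"
  assumes N: "smooth_manifold N" and D: "affine_connection N D"
begin

lemmas connection_axioms =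
  D[unfolded affine_connection_def, THEN conjunct1, rule_format, OF conjI[OF _ conjI]]

lemma connection_mem:
  assumes "openin (topo N) U" "q \<in> U" "smooth_field_on N U Y" "u \<in> tangent_space N q"
  shows "D q u Y \<in> tangent_space N q"
  by (rule connection_axioms[OF assms, THEN conjunct1])

lemma connection_scale_direction:
  assumes "openin (topo N) U" "q \<in> U" "smooth_field_on N U Y" "u \<in> tangent_space N q"
  shows "D q (\<lambda>\<phi>. a * u \<phi>) Y = (\<lambda>\<phi>. a * D q u Y \<phi>)"
  using connection_axioms[OF assms, THEN conjunct2, THEN conjunct1, rule_format, OF assms(4), of a 0]
  by simp

lemma connection_add_field:
  assumes "openin (topo N) U" "q \<in> U" "smooth_field_on N U Y" "smooth_field_on N U Z"
    "u \<in> tangent_space N q"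
  shows "D q u (\<lambda>r \<phi>. Y r \<phi> + Z r \<phi>) = (\<lambda>\<phi>. D q u Y \<phi> + D q u Z \<phi>)"
  by (rule connection_axioms[OF assms(1-3,5), THEN conjunct2, THEN conjunct2, THEN conjunct1,
        rule_format, OF assms(4)])

lemma connection_leibniz:
  assumes "openin (topo N) U" "q \<in> U" "smooth_field_on N U Y" "smooth_fun_on N U \<eta>"
    "u \<in> tangent_space N q"
  shows "D q u (\<lambda>r \<phi>. \<eta> r * Y r \<phi>) = (\<lambda>\<phi>. u \<eta> * Y q \<phi> + \<eta> q * D q u Y \<phi>)"
  by (rule connection_axioms[OF assms(1-3,5), THEN conjunct2, THEN conjunct2, THEN conjunct2,
        rule_format, OF assms(4)])

lemma connection_scale_field:
  assumes "openin (topo N) U" "q \<in> U" "smooth_field_on N U Y" "u \<in> tangent_space N q"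
  shows "D q u (\<lambda>r \<phi>. a * Y r \<phi>) = (\<lambda>\<phi>. a * D q u Y \<phi>)"
proof -
  have "q \<in> pts N" using assms(1,2) openin_subset by blast
  then show ?thesis
    using connection_leibniz[OF assms(1-3) smooth_fun_on_const[OF N assms(1), of a] assms(4)]
    by (simp add: tangent_const[OF N assms(4)])
qed

lemma connection_smooth:
  assumes "openin (topo N) U" "smooth_field_on N U X" "smooth_field_on N U Y"
  shows "smooth_field_on N U (\<lambda>q. D q (X q) Y)"
  by (rule D[unfolded affine_connection_def, THEN conjunct2, rule_format, OF conjI[OF assms(1) conjI]])
    (use assms in auto)

text \<open>A connection is local.  If \<open>Z\<close> vanishes on \<open>U\<close> and \<open>\<eta>\<close> is \<open>0\<close> on \<open>U\<close> and \<open>1\<close> elsewhere,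
  then \<open>\<eta>\<close> is smooth on \<open>U\<close> and \<open>\<eta> Z = Z\<close>, so the Leibniz rule at a point of \<open>U\<close> gives zero.
  This matters because a connection is applied to fields whose values outside \<open>U\<close> are
  unspecified, such as \<open>r \<mapsto> D\<^sub>X Y\<close> for \<open>X\<close> and \<open>Y\<close> smooth on \<open>U\<close> only.\<close>

lemma connection_local:
  assumes U: "openin (topo N) U" "q \<in> U" and Y: "smooth_field_on N U Y"
    and eq: "\<And>r. r \<in> U \<Longrightarrow> Y' r = Y r" and u: "u \<in> tangent_space N q"
  shows "D q u Y' = D q u Y"
proof -
  define Z where "Z = (\<lambda>r \<phi>. Y' r \<phi> - Y r \<phi>)"
  define \<eta> :: "'b \<Rightarrow> real" where "\<eta> = (\<lambda>r. if r \<in> U then 0 else 1)"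
  have Z0: "Z r = (\<lambda>_. 0)" if "r \<in> U" for r using that eq by (simp add: Z_def)
  then have Z: "smooth_field_on N U Z" using smooth_field_on_zero[OF N U(1)] by blast
  have "smooth_fun_on N U \<eta>"
    by (rule smooth_fun_on_cong[OF N U(1) smooth_fun_on_const[OF N U(1), of 0]]) (simp add: \<eta>_def)
  then have "D q u (\<lambda>r \<phi>. \<eta> r * Z r \<phi>) = (\<lambda>\<phi>. u \<eta> * Z q \<phi> + \<eta> q * D q u Z \<phi>)"
    using connection_leibniz U Z u by blast
  also have "(\<lambda>r \<phi>. \<eta> r * Z r \<phi>) = Z" by (intro ext) (simp add: \<eta>_def Z0)
  finally have "D q u Z = (\<lambda>_. 0)" using U(2) by (simp add: Z0 \<eta>_def)
  moreover have "D q u (\<lambda>r \<phi>. Y r \<phi> + Z r \<phi>) = (\<lambda>\<phi>. D q u Y \<phi> + D q u Z \<phi>)"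
    using connection_add_field U Y Z u by blast
  moreover have "(\<lambda>r \<phi>. Y r \<phi> + Z r \<phi>) = Y'" by (simp add: Z_def)
  ultimately show ?thesis by simp
qed

end

text \<open>Constants pull out of both slots of \<open>D\<close>, so \<open>D\<^bsub>aE\<^esub> D\<^bsub>bE\<^esub> W\<close> and \<open>D\<^bsub>bE\<^esub> D\<^bsub>aE\<^esub> W\<close> both equal
  \<open>a b D\<^bsub>E\<^esub> D\<^bsub>E\<^esub> W\<close>.  The bracket \<open>[aE, bE]\<close> is zero because torsion-freeness expresses
  it as a difference of two equal derivatives.  The field \<open>r \<mapsto> D\<^bsub>bE\<^esub> W\<close> is \<open>b\<close> times \<open>r \<mapsto> D\<^bsub>E\<^esub> W\<close>
  on \<open>U\<close> only, which suffices by locality.\<close>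

lemma curvature_field_parallel:
  assumes N: "smooth_manifold N" and L: "levi_civita N h D"
    and U: "openin (topo N) U" "q \<in> U"
    and E: "smooth_field_on N U E" and W: "smooth_field_on N U W"
  shows "curvature_field N D (\<lambda>r \<phi>. a * E r \<phi>) (\<lambda>r \<phi>. b * E r \<phi>) W q = (\<lambda>_. 0)"
proof -
  have D: "affine_connection N D" using L unfolding levi_civita_def by blast
  have Er: "E r \<in> tangent_space N r" if "r \<in> U" for r using smooth_field_onD(1)[OF N E that] .
  have cE: "smooth_field_on N U (\<lambda>r \<phi>. c * E r \<phi>)" for c
    using smooth_field_on_lin[OF N U(1) E E, of c 0] by simp
  define G where "G = (\<lambda>r. D r (E r) W)"
  have G: "smooth_field_on N U G" unfolding G_def by (rule connection_smooth[OF N D U(1) E W])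
  have cG: "smooth_field_on N U (\<lambda>r \<phi>. c * G r \<phi>)" for c
    using smooth_field_on_lin[OF N U(1) G G, of c 0] by simp
  have second: "D q (\<lambda>\<phi>. s * E q \<phi>) (\<lambda>r. D r (\<lambda>\<phi>. t * E r \<phi>) W) = (\<lambda>\<phi>. s * (t * D q (E q) G \<phi>))"
    for s t
  proof -
    have F: "D r (\<lambda>\<phi>. t * E r \<phi>) W = (\<lambda>\<phi>. t * G r \<phi>)" if "r \<in> U" for r
      unfolding G_def by (rule connection_scale_direction[OF N D U(1) that W Er[OF that]])
    have sE: "(\<lambda>\<phi>. s * E q \<phi>) \<in> tangent_space N q" using smooth_field_onD(1)[OF N cE U(2)] .
    have "D q (\<lambda>\<phi>. s * E q \<phi>) (\<lambda>r. D r (\<lambda>\<phi>. t * E r \<phi>) W) = D q (\<lambda>\<phi>. s * E q \<phi>) (\<lambda>r \<phi>. t * G r \<phi>)"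
      by (rule connection_local[OF N D U cG F sE])
    also have "\<dots> = (\<lambda>\<phi>. s * D q (E q) (\<lambda>r \<phi>. t * G r \<phi>) \<phi>)"
      by (rule connection_scale_direction[OF N D U cG Er[OF U(2)]])
    also have "D q (E q) (\<lambda>r \<phi>. t * G r \<phi>) = (\<lambda>\<phi>. t * D q (E q) G \<phi>)"
      by (rule connection_scale_field[OF N D U G Er[OF U(2)]])
    finally show ?thesis .
  qed
  have first: "D q (\<lambda>\<phi>. s * E q \<phi>) (\<lambda>r \<phi>. t * E r \<phi>) = (\<lambda>\<phi>. s * (t * D q (E q) E \<phi>))" for s t
    using connection_scale_direction[OF N D U cE Er[OF U(2)]]
      connection_scale_field[OF N D U E Er[OF U(2)]] by simp
  have "bracket N (\<lambda>r \<phi>. a * E r \<phi>) (\<lambda>r \<phi>. b * E r \<phi>) q =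
      (\<lambda>\<phi>. D q (\<lambda>\<phi>. a * E q \<phi>) (\<lambda>r \<phi>. b * E r \<phi>) \<phi> - D q (\<lambda>\<phi>. b * E q \<phi>) (\<lambda>r \<phi>. a * E r \<phi>) \<phi>)"
    by (rule L[unfolded levi_civita_def, THEN conjunct2, THEN conjunct1, rule_format,
          OF conjI[OF U(1) conjI[OF U(2) conjI[OF cE cE]]], symmetric])
  also have "\<dots> = (\<lambda>\<phi>. 0 * E q \<phi>)" unfolding first by simp
  finally have "D q (bracket N (\<lambda>r \<phi>. a * E r \<phi>) (\<lambda>r \<phi>. b * E r \<phi>) q) W = (\<lambda>_. 0)"
    using connection_scale_direction[OF N D U W Er[OF U(2)], of 0] by simp
  then show ?thesis unfolding curvature_field_def second by (simp add: fun_eq_iff)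
qed

lemma curvature_parallel:
  assumes N: "smooth_manifold N" and L: "levi_civita N h D" and q: "q \<in> pts N"
  shows "curvature N D q (\<lambda>\<phi>. a * z \<phi>) (\<lambda>\<phi>. b * z \<phi>) w = (\<lambda>_. 0)"
proof -
  let ?E = "extend_const N (chart_at N q)"
  note c = chart_at[OF N q]
  have E: "?E (\<lambda>\<phi>. a * z \<phi>) = (\<lambda>r \<phi>. a * ?E z r \<phi>)" for a
    by (intro ext) (simp add: extend_const_def lincomb_def sum_distrib_left mult.assoc)
  show ?thesis
    unfolding curvature_def Let_def E[of a] E[of b]
    by (rule curvature_field_parallel[OF N L openin_dom[OF N c(1)] c(2)
          smooth_field_on_extend_const[OF N c(1)] smooth_field_on_extend_const[OF N c(1)]])
qed

text \<open>The hypothesis on sectional curvature speaks of independent pairs only, where its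
  denominator is positive; for a dependent pair one vector is a multiple of the other and the
  curvature vanishes.\<close>

lemma curvature_term_nonpos:
  assumes R: "riemannian_manifold N h" and L: "levi_civita N h D"
    and K: "nonpositive_sectional_curvature N h D"
    and q: "q \<in> pts N" and X: "X \<in> tangent_space N q" and Y: "Y \<in> tangent_space N q"
  shows "h q (curvature N D q X Y Y) X \<le> 0"
proof -
  have N: "smooth_manifold N" using R unfolding riemannian_manifold_def by blast
  interpret tvec_inner_product "tangent_space N q" "h q"
    by (rule riemannian_tvec_inner_product[OF R q])
  show ?thesis
  proof (cases "\<forall>a b. (\<lambda>\<phi>. a * X \<phi> + b * Y \<phi>) = (\<lambda>_. 0) \<longrightarrow> a = 0 \<and> b = 0")
    case True
    then have "sectional_curvature N h D q X Y \<le> 0"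
      using K q X Y unfolding nonpositive_sectional_curvature_def by blast
    moreover have "0 < h q X X * h q Y Y - (h q X Y)\<^sup>2"
      using gram_determinant_pos[OF X Y] True by blast
    ultimately show ?thesis unfolding sectional_curvature_def by (simp add: divide_le_0_iff)
  next
    case False
    then obtain a b where "a \<noteq> 0 \<or> b \<noteq> 0" and "(\<lambda>\<phi>. a * X \<phi> + b * Y \<phi>) = (\<lambda>_. 0)" by blast
    then have ab: "a \<noteq> 0 \<or> b \<noteq> 0" and rel: "a * X \<phi> + b * Y \<phi> = 0" for \<phi>
      by (auto simp: fun_eq_iff)
    have "curvature N D q X Y Y = (\<lambda>_. 0)"
    proof (cases "a = 0")
      case True
      then have "Y = (\<lambda>\<phi>. 0 * X \<phi>)" using ab rel by (intro ext) simp
      then show ?thesis using curvature_parallel[OF N L q, of 1 X 0 Y] by simp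
    next
      case False
      have "X \<phi> = (- b / a) * Y \<phi>" for \<phi>
        using rel[of \<phi>] False by (simp add: field_simps eq_neg_iff_add_eq_0)
      then have "X = (\<lambda>\<phi>. (- b / a) * Y \<phi>)" by blast
      then show ?thesis using curvature_parallel[OF N L q, of "- b / a" Y 1 Y] by simp
    qed
    then show ?thesis by (simp add: ip_zero[OF X])
  qed
qed

lemma pullback_connection_tangent:
  assumes M: "smooth_manifold M" and N: "smooth_manifold N" and D: "affine_connection N D"
    and f: "smooth_map M N f" and p: "p \<in> pts M" and X: "X \<in> tangent_space M p"
  shows "pullback_connection N D f p X V \<in> tangent_space N (f p)"
proof -
  have fp: "f p \<in> pts N"
    using f p unfolding smooth_map_def continuous_map_def by blast
  note d = chart_at[OF N fp]
  note dX = push_tangent[OF M N f p X]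
  show ?thesis
    unfolding pullback_connection_def Let_def
    by (rule tangent_space_sum[OF N finite], rule tangent_space_lin[OF N],
        rule coord_vec_tangent[OF N d],
        rule connection_mem[OF N D openin_dom[OF N d(1)] d(2) smooth_field_on_coord_vec[OF N d(1)] dX])
qed

section \<open>Stability\<close>

theorem proposition3p2:
  fixes M :: "('a, 'k::finite) mfd" and g :: "'a metric_tensor" and m d :: nat
    and H :: "'a \<Rightarrow> 'a tvec set"
    and N :: "('b, 'n::finite) mfd" and h :: "'b metric_tensor" and D :: "'b connection"
    and f :: "'a \<Rightarrow> 'b"
  assumes "CARD('k) = m + d"
    and "sub_riemannian_manifold M g m H"
    and "compact_space (topo M)" and "connected_space (topo M)"
    and "riemannian_manifold N h"
    and "levi_civita N h D"
    and "exp_subelliptic_harmonic M g m H N h f"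
    and "nonpositive_sectional_curvature N h D"
  shows "exp_subelliptic_stable M g m H N h D f"
  unfolding exp_subelliptic_stable_def
proof (intro allI impI)
  fix V assume V: "smooth_field_along_on M N f (pts M) V \<and> compact_support M V"
  have M: "smooth_manifold M" and N: "smooth_manifold N"
    using assms(2,5) unfolding sub_riemannian_manifold_def riemannian_manifold_def by auto
  have D: "affine_connection N D" using assms(6) unfolding levi_civita_def by blast
  have f: "smooth_map M N f" using assms(7) unfolding exp_subelliptic_harmonic_def by blast
  let ?e = "frame g m H"
  let ?nab = "\<lambda>p i. pullback_connection N D f p (?e p i) V"
  let ?Q = "\<lambda>p. exp (norm2_dfH g m H N h f p / 2) *
    ((\<Sum>i<m. h (f p) (?nab p i) (push N f p (?e p i)))\<^sup>2
     + (\<Sum>i<m. h (f p) (?nab p i) (?nab p i))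
     - (\<Sum>i<m. h (f p) (curvature N D (f p) (push N f p (?e p i)) (V p) (V p))
          (push N f p (?e p i))))"
  have "0 \<le> ?Q p" if p: "p \<in> pts M" for p
  proof -
    have fp: "f p \<in> pts N"
      using f p unfolding smooth_map_def continuous_map_def by blast
    interpret tvec_inner_product "tangent_space N (f p)" "h (f p)"
      by (rule riemannian_tvec_inner_product[OF assms(5) fp])
    note e = frame_orthonormal(2)[OF assms(2) p]
    have Vp: "V p \<in> tangent_space N (f p)"
      using V p unfolding smooth_field_along_on_def by blast
    have "0 \<le> (\<Sum>i<m. h (f p) (?nab p i) (?nab p i))"
      by (intro sum_nonneg ip_nonneg pullback_connection_tangent[OF M N D f p] e) simp
    moreover have "(\<Sum>i<m. h (f p) (curvature N D (f p) (push N f p (?e p i)) (V p) (V p))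
          (push N f p (?e p i))) \<le> 0"
      by (intro sum_nonpos curvature_term_nonpos[OF assms(5,6,8) fp] push_tangent[OF M N f p] e Vp)
        simp
    ultimately show ?thesis
      using zero_le_power2[of "\<Sum>i<m. h (f p) (?nab p i) (push N f p (?e p i))"]
      by (intro mult_nonneg_nonneg) (simp, linarith)
  qed
  then show "0 \<le> index_form M g m H N h D f V"
    unfolding index_form_def Let_def set_lebesgue_integral_def
    by (intro Bochner_Integration.integral_nonneg) (simp add: indicator_def)
qed

end
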